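(* Let $S$ be a far-flung Gorenstein numerical semigroup with $t(S)\ge2$. If $m(S)\ge\overline{n}(t(S)-1)+1$, then $S$ has maximal reduced type. In particular, if $m(S)=\overline{n}(t(S))$, then $S$ has maximal reduced type.
   Context: $\mathbb{N}$ denotes the non-negative integers. For integers $x\le y$, $[x,y]=\{z\in\mathbb{Z}\mid x\le z\le y\}$. For sets of integers, $A+B=\{a+b\mid a\in A,b\in B\}$ and $I-J=\{z\in\mathbb{Z}\mid z+y\in I\text{ for all }y\in J\}$ (set difference is written $\setminus$). A numerical semigroup is a submonoid $S$ of $(\mathbb{N},+)$ with $\mathbb{N}\setminus S$ finite. Its multiplicity $m(S)$ is the smallest element of $S\setminus\{0\}$; its Frobenius number $F(S)$ is the largest integer in $\mathbb{Z}\setminus S$. $PF(S)=\{x\in\mathbb{Z}\setminus S\mid x+s\in S\text{ for all }0\ne s\in S\}$, and the type is $t(S)=|PF(S)|$. Put $rPF(S)=[F(S)-m(S)+1,F(S)]\setminus S$ (a subset of $PF(S)$); the reduced type is $s(S)=|rPF(S)|$. $S$ has maximal reduced type if $s(S)=t(S)$, i.e. $rPF(S)=PF(S)$. Let $C(S)=\{z\in\mathbb{Z}\mid z\ge F(S)+1\}$, $K(S)=\{x\in\mathbb{Z}\mid F(S)-x\notin S\}$, and $\mathrm{tr}(K(S))=K(S)+(S-K(S))$. $S$ is far-flung Gorenstein if $\mathrm{tr}(K(S))=C(S)$. For a finite set $A\subset\mathbb{N}$ with $0\in A$, $n(A)$ is the integer such that $0,1,\dots,n(A)-1\in A+A$ and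 $n(A)\notin A+A$; if $0\notin A$, $n(A)=-1$. For a positive integer $t$, $\overline{n}(t)=\max\{n(A)\mid A\subset\mathbb{N},\ |A|=t\}$. *)

theory Defs
  imports Main "HOL-Library.Set_Algebras"
begin

text \<open>
  A numerical semigroup is represented as a set of integers contained in \<open>\<nat>\<close>, because the
  Frobenius number, the pseudo-Frobenius numbers and the relative ideals below live in the
  integers. For sets, \<open>A + B\<close> is the elementwise sum (\<^theory>\<open>HOL-Library.Set_Algebras\<close>), while
  \<open>A - B\<close> is always the set difference.
\<close>

definition numerical_semigroup :: "int set \<Rightarrow> bool" where
  "numerical_semigroup S \<longleftrightarrow>
     S \<subseteq> \<nat> \<and> 0 \<in> S \<and> (\<forall>x\<in>S. \<forall>y\<in>S. x + y \<in> S) \<and> finite (\<nat> - S)"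

definition sg_mult :: "int set \<Rightarrow> int" where
  "sg_mult S = (LEAST x. x \<in> S - {0})"

text \<open>The maximum ranges over all integers outside \<open>S\<close>, so it is \<open>-1\<close> for \<open>S = \<nat>\<close>.\<close>

definition frobenius :: "int set \<Rightarrow> int" where
  "frobenius S = (GREATEST x. x \<notin> S)"

definition pseudo_frobenius :: "int set \<Rightarrow> int set" where
  "pseudo_frobenius S = {x. x \<notin> S \<and> (\<forall>s\<in>S. s \<noteq> 0 \<longrightarrow> x + s \<in> S)}"

definition sg_type :: "int set \<Rightarrow> nat" where
  "sg_type S = card (pseudo_frobenius S)"

definition reduced_pseudo_frobenius :: "int set \<Rightarrow> int set" where
  "reduced_pseudo_frobenius S = {frobenius S - sg_mult S + 1 .. frobenius S} - S"

definition reduced_type :: "int set \<Rightarrow> nat" where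
  "reduced_type S = card (reduced_pseudo_frobenius S)"

definition maximal_reduced_type :: "int set \<Rightarrow> bool" where
  "maximal_reduced_type S \<longleftrightarrow> reduced_type S = sg_type S"

definition ideal_quotient :: "int set \<Rightarrow> int set \<Rightarrow> int set" where
  "ideal_quotient I J = {z. \<forall>y\<in>J. z + y \<in> I}"

definition conductor_ideal :: "int set \<Rightarrow> int set" where
  "conductor_ideal S = {z. z \<ge> frobenius S + 1}"

definition canonical_ideal :: "int set \<Rightarrow> int set" where
  "canonical_ideal S = {x. frobenius S - x \<notin> S}"

definition canonical_trace :: "int set \<Rightarrow> int set" where
  "canonical_trace S = canonical_ideal S + ideal_quotient S (canonical_ideal S)"

definition far_flung_Gorenstein :: "int set \<Rightarrow> bool" where
  "far_flung_Gorenstein S \<longleftrightarrow> canonical_trace S = conductor_ideal S"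

text \<open>
  The number \<open>n\<close> with \<open>0, \<dots>, n - 1 \<in> A + A\<close> and \<open>n \<notin> A + A\<close> is the least natural number
  outside \<open>A + A\<close>; it exists because \<open>A\<close> is finite wherever this is used.
\<close>

definition basis_reach :: "nat set \<Rightarrow> int" where
  "basis_reach A = (if 0 \<in> A then int (LEAST k. k \<notin> A + A) else -1)"

text \<open>
  For a fixed \<open>t\<close> the set below is finite, since \<open>A + A\<close> has at most \<open>t\<^sup>2\<close> elements.
\<close>

definition max_basis_reach :: "nat \<Rightarrow> int" where
  "max_basis_reach t = Max {basis_reach A | A. finite A \<and> card A = t}"

end

theory Submission
  imports Defs
begin

text \<open>
  Since \<open>0 \<in> K(S)\<close>, far-flung Gorensteinness forces \<open>S - K(S) \<subseteq> C(S)\<close>, that is, every natural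
  number is a sum of two elements of \<open>K(S)\<close>. The elements of \<open>K(S)\<close> below \<open>m(S)\<close> are exactly the
  numbers \<open>F(S) - p\<close> with \<open>p \<in> rPF(S)\<close>; they form a set \<open>A\<close> of size \<open>s(S)\<close> whose sumset contains
  \<open>0, \<dots>, m(S) - 1\<close>, so the maximal reach of an \<open>s(S)\<close>-element set is at least \<open>m(S)\<close>. That
  maximum is strictly increasing in the size, because adjoining to \<open>A\<close> the first number missing
  from \<open>A + A\<close> extends the reach. Hence \<open>s(S) < t(S)\<close> contradicts either hypothesis on \<open>m(S)\<close>.
\<close>

section \<open>Sumsets of finite sets and the growth of the maximal reach\<close>

lemma finite_sumset_nat:
  fixes A :: "nat set"
  assumes "finite A"
  shows "finite (A + A)" and "card (A + A) \<le> card A * card A"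
proof -
  have eq: "A + A = (\<lambda>(a, b). a + b) ` (A \<times> A)"
    by (auto simp: set_plus_def)
  show "finite (A + A)"
    unfolding eq using assms by simp
  show "card (A + A) \<le> card A * card A"
    unfolding eq using card_image_le[of "A \<times> A"] assms by (simp add: card_cartesian_product)
qed

lemma ex_not_in_sumset:
  fixes A :: "nat set"
  assumes "finite A"
  shows "\<exists>k. k \<notin> A + A"
  using ex_new_if_finite[OF infinite_UNIV_nat finite_sumset_nat(1)[OF assms]] .

lemma basis_reach_geI:
  assumes "finite A" "0 \<in> A" "\<And>k. k < n \<Longrightarrow> k \<in> A + A"
  shows "int n \<le> basis_reach A"
proof -
  have "(LEAST k. k \<notin> A + A) \<notin> A + A"
    using ex_not_in_sumset[OF assms(1)] by (rule LeastI_ex)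
  then show ?thesis
    using assms(2,3) by (force simp: basis_reach_def not_less)
qed

text \<open>The numbers below the reach all lie in \<open>A + A\<close>, so its size caps the reach.
  These bounds make the set under \<open>Max\<close> in \<open>max_basis_reach\<close>
  finite.\<close>

lemma basis_reach_bounds:
  assumes "finite A"
  shows "- 1 \<le> basis_reach A" and "basis_reach A \<le> int (card A * card A)"
proof -
  show "- 1 \<le> basis_reach A"
    by (simp add: basis_reach_def)
  have sub: "{..<LEAST k. k \<notin> A + A} \<subseteq> A + A"
    by (auto dest: not_less_Least)
  have "(LEAST k. k \<notin> A + A) \<le> card (A + A)"
    using card_mono[OF finite_sumset_nat(1)[OF assms] sub] by simp
  also have "\<dots> \<le> card A * card A"
    by (rule finite_sumset_nat(2)[OF assms])
  finally show "basis_reach A \<le> int (card A * card A)"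
    by (simp add: basis_reach_def flip: of_nat_mult)
qed

lemma finite_basis_reaches: "finite {basis_reach A | A. finite A \<and> card A = t}"
proof (rule finite_subset)
  show "{basis_reach A | A. finite A \<and> card A = t} \<subseteq> {- 1..int (t * t)}"
    using basis_reach_bounds by fastforce
qed simp

lemma basis_reach_le_max:
  assumes "finite A"
  shows "basis_reach A \<le> max_basis_reach (card A)"
  unfolding max_basis_reach_def by (rule Max_ge[OF finite_basis_reaches]) (use assms in auto)

lemma max_basis_reach_attained:
  obtains A where "finite A" "card A = t" "max_basis_reach t = basis_reach A"
proof -
  have "basis_reach {..<t} \<in> {basis_reach A | A. finite A \<and> card A = t}"
    by (intro CollectI exI[of _ "{..<t}"]) simp
  then have "max_basis_reach t \<in> {basis_reach A | A. finite A \<and> card A = t}"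
    unfolding max_basis_reach_def by (intro Max_in[OF finite_basis_reaches]) auto
  then show ?thesis
    using that by auto
qed

lemma max_basis_reach_pos:
  assumes "t > 0"
  shows "max_basis_reach t > 0"
proof -
  have "int 1 \<le> basis_reach {..<t}"
    by (rule basis_reach_geI) (use assms in \<open>auto simp: set_plus_def\<close>)
  with basis_reach_le_max[of "{..<t}"] show ?thesis
    by simp
qed

lemma max_basis_reach_less_Suc:
  assumes "t > 0"
  shows "max_basis_reach t < max_basis_reach (Suc t)"
proof -
  obtain A where A: "finite A" "card A = t" "max_basis_reach t = basis_reach A"
    using max_basis_reach_attained .
  \<comment> \<open>A positive maximum cannot be the default value -1 for sets without 0.\<close>
  have A0: "0 \<in> A"
    using max_basis_reach_pos[OF assms] A(3) by (auto simp: basis_reach_def split: if_splits)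
  define n where "n = (LEAST k. k \<notin> A + A)"
  have n: "n \<notin> A + A"
    unfolding n_def using ex_not_in_sumset[OF A(1)] by (rule LeastI_ex)
  have below: "k \<in> A + A" if "k < n" for k
    using not_less_Least[of k] that unfolding n_def by blast
  \<comment> \<open>Otherwise \<open>n = n + 0\<close> would be in \<open>A + A\<close>; so
    adjoining \<open>n\<close> really enlarges \<open>A\<close>.\<close>
  have "n \<notin> A"
    using n A0 set_plus_intro[of n A 0 A] by auto
  then have card: "card (insert n A) = Suc t"
    using A by simp
  have "int (Suc n) \<le> basis_reach (insert n A)"
  proof (rule basis_reach_geI)
    fix k assume "k < Suc n"
    then consider "k < n" | "k = n"
      by linarith
    then show "k \<in> insert n A + insert n A"
    proof cases
      case 1
      then show ?thesis
        using below set_plus_mono2[of A "insert n A" A "insert n A"] by blast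
    next
      case 2
      then show ?thesis
        using A0 set_plus_intro[of n "insert n A" 0 "insert n A"] by simp
    qed
  qed (use A A0 in auto)
  also have "\<dots> \<le> max_basis_reach (Suc t)"
    using basis_reach_le_max[of "insert n A"] A card by simp
  finally show ?thesis
    using A A0 by (simp add: basis_reach_def n_def)
qed

lemma max_basis_reach_mono:
  assumes "0 < s" "s \<le> t"
  shows "max_basis_reach s \<le> max_basis_reach t"
  using assms(2)
proof (induction t rule: dec_induct)
  case (step t)
  then show ?case
    using max_basis_reach_less_Suc[of t] assms(1) by linarith
qed simp

section \<open>Frobenius number, multiplicity and reduced type\<close>

lemma frobenius_properties:
  assumes "numerical_semigroup S"
  shows "frobenius S \<notin> S" and "x \<notin> S \<Longrightarrow> x \<le> frobenius S"
proof -
  have "- 1 \<notin> S"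
    using assms by (auto simp: numerical_semigroup_def Nats_altdef2)
  \<comment> \<open>The complement of \<open>S\<close> is infinite, but all its negative elements
    are at most -1, so this finite set has the same maximum. The -1 also covers the case without
    gaps.\<close>
  define B where "B = insert (- 1) (\<nat> - S)"
  have fin: "finite B" and ne: "B \<noteq> {}"
    using assms by (auto simp: B_def numerical_semigroup_def)
  have mem: "Max B \<notin> S"
    using Max_in[OF fin ne] \<open>- 1 \<notin> S\<close> by (auto simp: B_def)
  have ub: "y \<le> Max B" if "y \<notin> S" for y
  proof (cases "y \<ge> 0")
    case True
    with that show ?thesis
      by (intro Max_ge[OF fin]) (simp add: B_def Nats_altdef2 Ints_def)
  next
    case False
    then have "y \<le> - 1"
      by simp
    also have "\<dots> \<le> Max B"
      by (rule Max_ge[OF fin]) (simp add: B_def)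
    finally show ?thesis .
  qed
  have "frobenius S = Max B"
    unfolding frobenius_def using mem ub by (rule Greatest_equality)
  then show "frobenius S \<notin> S" and "x \<notin> S \<Longrightarrow> x \<le> frobenius S"
    using mem ub by simp_all
qed

lemma sg_mult_properties:
  assumes "numerical_semigroup S"
  shows "sg_mult S > 0" and "x \<in> S \<Longrightarrow> x \<noteq> 0 \<Longrightarrow> sg_mult S \<le> x"
proof -
  have nat: "S \<subseteq> \<nat>"
    using assms by (simp add: numerical_semigroup_def)
  \<comment> \<open>The integers are not well-ordered, so the minimum is found among the naturals
    and transferred.\<close>
  define P where "P = (\<lambda>n. int n \<in> S - {0})"
  have "P (nat (max 1 (frobenius S + 1)))"
    using frobenius_properties(2)[OF assms, of "max 1 (frobenius S + 1)"] by (auto simp: P_def)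
  then have P: "P (LEAST n. P n)"
    by (rule LeastI)
  have lb: "int (LEAST n. P n) \<le> y" if "y \<in> S - {0}" for y
  proof -
    have "y \<in> \<nat>"
      using that nat by blast
    then obtain n where "y = int n"
      by (auto elim: Nats_cases)
    then show ?thesis
      using that Least_le[of P n] by (simp add: P_def)
  qed
  have "sg_mult S = int (LEAST n. P n)"
    unfolding sg_mult_def using P lb by (intro Least_equality) (simp_all add: P_def)
  then show "sg_mult S > 0" and "x \<in> S \<Longrightarrow> x \<noteq> 0 \<Longrightarrow> sg_mult S \<le> x"
    using P lb by (auto simp: P_def)
qed

text \<open>Adding a nonzero element of \<open>S\<close>, hence at least m(S), to a number above
  F(S) - m(S) passes F(S).\<close>

lemma reduced_pseudo_frobenius_subset:
  assumes "numerical_semigroup S"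
  shows "reduced_pseudo_frobenius S \<subseteq> pseudo_frobenius S"
proof
  fix x assume x: "x \<in> reduced_pseudo_frobenius S"
  have "x + s \<in> S" if "s \<in> S" "s \<noteq> 0" for s
  proof (rule ccontr)
    assume "x + s \<notin> S"
    then have "x + s \<le> frobenius S"
      by (rule frobenius_properties(2)[OF assms])
    with x sg_mult_properties(2)[OF assms that] show False
      by (simp add: reduced_pseudo_frobenius_def)
  qed
  with x show "x \<in> pseudo_frobenius S"
    by (simp add: reduced_pseudo_frobenius_def pseudo_frobenius_def)
qed

section \<open>Canonical ideal and the far-flung condition\<close>

lemma canonical_ideal_nonneg:
  assumes "numerical_semigroup S" "x \<in> canonical_ideal S"
  shows "x \<ge> 0"
  using assms frobenius_properties(2)[OF assms(1), of "frobenius S - x"]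
  by (simp add: canonical_ideal_def)

lemma far_flung_canonical_sum:
  assumes "numerical_semigroup S" "far_flung_Gorenstein S" "n \<ge> 0"
  obtains a b where "a \<in> canonical_ideal S" "b \<in> canonical_ideal S" "n = a + b"
proof -
  \<comment> \<open>As F(S) - n is not in C(S), it is not in S - K(S): some a in K(S) has F(S) - (n
    - a) outside S, which says that n - a is in K(S).\<close>
  define z where "z = frobenius S - n"
  have "0 \<in> canonical_ideal S"
    using frobenius_properties(1)[OF assms(1)] by (simp add: canonical_ideal_def)
  then have "ideal_quotient S (canonical_ideal S) \<subseteq> canonical_trace S"
    unfolding canonical_trace_def by (rule set_zero_plus2)
  moreover have "z \<notin> canonical_trace S"
    using assms by (simp add: far_flung_Gorenstein_def conductor_ideal_def z_def)
  ultimately obtain a where a: "a \<in> canonical_ideal S" "z + a \<notin> S"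
    by (auto simp: ideal_quotient_def)
  then have "n - a \<in> canonical_ideal S"
    by (simp add: canonical_ideal_def z_def algebra_simps)
  with a(1) show ?thesis
    by (rule that) simp
qed

lemma sg_mult_le_max_basis_reach:
  assumes "numerical_semigroup S" "far_flung_Gorenstein S"
  shows "sg_mult S \<le> max_basis_reach (reduced_type S)"
proof -
  define A where "A = (\<lambda>p. nat (frobenius S - p)) ` reduced_pseudo_frobenius S"
  have "inj_on (\<lambda>p. nat (frobenius S - p)) (reduced_pseudo_frobenius S)"
    by (auto simp: inj_on_def reduced_pseudo_frobenius_def)
  then have card: "card A = reduced_type S"
    unfolding A_def reduced_type_def by (rule card_image)
  have fin: "finite A"
    by (simp add: A_def reduced_pseudo_frobenius_def)
  \<comment> \<open>From 0 \<le> a < m(S), the number F(S) - a falls in the window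
    [F(S) - m(S) + 1, F(S)] defining rPF(S).\<close>
  have A_mem: "nat a \<in> A" if "a \<in> canonical_ideal S" "a < sg_mult S" for a
    unfolding A_def
    by (rule image_eqI[of _ _ "frobenius S - a"])
      (use that canonical_ideal_nonneg[OF assms(1) that(1)] in
        \<open>auto simp: reduced_pseudo_frobenius_def canonical_ideal_def\<close>)
  have m: "sg_mult S > 0"
    by (rule sg_mult_properties(1)[OF assms(1)])
  have "int (nat (sg_mult S)) \<le> basis_reach A"
  proof (rule basis_reach_geI[OF fin])
    show "0 \<in> A"
      using A_mem[of 0] m frobenius_properties(1)[OF assms(1)]
      by (simp add: canonical_ideal_def)
  next
    fix k assume "k < nat (sg_mult S)"
    then have k: "int k < sg_mult S"
      by simp
    obtain a b where ab: "a \<in> canonical_ideal S" "b \<in> canonical_ideal S" "int k = a + b"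
      using far_flung_canonical_sum[OF assms, of "int k"] by auto
    have nonneg: "a \<ge> 0" "b \<ge> 0"
      using canonical_ideal_nonneg[OF assms(1)] ab by blast+
    \<comment> \<open>Both summands are nonnegative with sum below m(S), so each is below
      m(S).\<close>
    then have "nat a \<in> A" "nat b \<in> A"
      using A_mem ab k by simp_all
    moreover have "k = nat a + nat b"
      using ab(3) nonneg by simp
    ultimately show "k \<in> A + A"
      by (simp add: set_plus_intro)
  qed
  also have "\<dots> \<le> max_basis_reach (reduced_type S)"
    using basis_reach_le_max[OF fin] card by simp
  finally show ?thesis
    using m by simp
qed

lemma reduced_type_pos:
  assumes "numerical_semigroup S"
  shows "reduced_type S > 0"
proof -
  have "frobenius S \<in> reduced_pseudo_frobenius S"
    using frobenius_properties(1)[OF assms] sg_mult_properties(1)[OF assms]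
    by (simp add: reduced_pseudo_frobenius_def)
  moreover have "finite (reduced_pseudo_frobenius S)"
    by (simp add: reduced_pseudo_frobenius_def)
  ultimately show ?thesis
    by (auto simp: reduced_type_def card_gt_0_iff)
qed

theorem proposition1:
  fixes S :: "int set"
  assumes "numerical_semigroup S"
    and "far_flung_Gorenstein S"
    and "sg_type S \<ge> 2"
  shows "(sg_mult S \<ge> max_basis_reach (sg_type S - 1) + 1 \<longrightarrow> maximal_reduced_type S) \<and>
         (sg_mult S = max_basis_reach (sg_type S) \<longrightarrow> maximal_reduced_type S)"
proof -
  \<comment> \<open>An infinite set would have \<open>card\<close> equal to 0.\<close>
  have "finite (pseudo_frobenius S)"
    using assms(3) by (intro card_ge_0_finite) (simp add: sg_type_def)
  then have le: "reduced_type S \<le> sg_type S"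
    unfolding reduced_type_def sg_type_def
    using reduced_pseudo_frobenius_subset[OF assms(1)] by (rule card_mono)
  have main: "maximal_reduced_type S" if "sg_mult S \<ge> max_basis_reach (sg_type S - 1) + 1"
  proof (rule ccontr)
    assume "\<not> maximal_reduced_type S"
    with le have "reduced_type S \<le> sg_type S - 1"
      by (simp add: maximal_reduced_type_def)
    with reduced_type_pos[OF assms(1)]
    have "max_basis_reach (reduced_type S) \<le> max_basis_reach (sg_type S - 1)"
      by (rule max_basis_reach_mono)
    with sg_mult_le_max_basis_reach[OF assms(1,2)] that show False
      by linarith
  qed
  \<comment> \<open>Over the integers this strict increase turns the second hypothesis into the
    first; t(S) \<ge> 2 makes the smaller size positive.\<close>
  moreover have "max_basis_reach (sg_type S - 1) < max_basis_reach (sg_type S)"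
    using max_basis_reach_less_Suc[of "sg_type S - 1"] assms(3) by simp
  ultimately show ?thesis
    by simp
qed

end
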